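(* Let $M$ be a loopless matroid on a finite set $E$ with rank function $r$. For subsets $S_1,\ldots,S_k \subseteq E$ put $\tilde r(S_1,\ldots,S_k) := \sum_{i=1}^k (2r(S_i)-1)$, and define $r': 2^E \to \mathbb{N}$ by \[ r'(S) := \min \tilde r(P_1,\ldots,P_k), \] the minimum taken over all partitions $\{P_1,\ldots,P_k\}$ of $S$. Then $r'$ is the rank function of a matroid $M'$ on $E$.
   Context: A partition of a finite set $S$ is a set of pairwise disjoint nonempty subsets of $S$ whose union is $S$; the empty set has the empty partition (with $k=0$, giving value $0$). *)

theory Defs
  imports Main "HOL-Library.Disjoint_Sets"
begin

locale matroid =
  fixes E :: "'a set" and indep :: "'a set \<Rightarrow> bool"
  assumes finite_ground: "finite E"
    and indep_subset_ground: "indep X \<Longrightarrow> X \<subseteq> E"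
    and indep_empty: "indep {}"
    and indep_hereditary: "indep X \<Longrightarrow> Y \<subseteq> X \<Longrightarrow> indep Y"
    and indep_augment:
      "indep X \<Longrightarrow> indep Y \<Longrightarrow> card X < card Y \<Longrightarrow> \<exists>y\<in>Y - X. indep (insert y X)"

definition matroid_rank :: "('a set \<Rightarrow> bool) \<Rightarrow> 'a set \<Rightarrow> nat" where
  "matroid_rank indep S = Max (card ` {X. X \<subseteq> S \<and> indep X})"

definition is_loop :: "'a set \<Rightarrow> ('a set \<Rightarrow> bool) \<Rightarrow> 'a \<Rightarrow> bool" where
  "is_loop E indep e \<longleftrightarrow> e \<in> E \<and> \<not> indep {e}"

definition loopless :: "'a set \<Rightarrow> ('a set \<Rightarrow> bool) \<Rightarrow> bool" where
  "loopless E indep \<longleftrightarrow> (\<nexists>e. is_loop E indep e)"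

text \<open>
  The sum is taken in the integers, so that the subtraction is not truncated.
\<close>

definition r_tilde :: "('a set \<Rightarrow> nat) \<Rightarrow> 'a set set \<Rightarrow> int" where
  "r_tilde r P = (\<Sum>S\<in>P. 2 * int (r S) - 1)"

definition r_prime :: "('a set \<Rightarrow> nat) \<Rightarrow> 'a set \<Rightarrow> int" where
  "r_prime r S = Min (r_tilde r ` {P. partition_on S P})"

text \<open>
  For a finite set the minimum ranges over a finite nonempty set, so it is attained; the empty set
  has only the empty partition.
\<close>

lemma r_prime_attained:
  assumes "finite S"
  shows "\<exists>P. partition_on S P \<and> r_prime r S = r_tilde r P"
    and "partition_on S Q \<Longrightarrow> r_prime r S \<le> r_tilde r Q"
proof -
  have fin: "finite (r_tilde r ` {P. partition_on S P})"
    using finitely_many_partition_on[OF assms] by simp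
  have "partition_on S ((\<lambda>x. {x}) ` S)"
    by (auto simp: partition_on_def disjoint_def)
  then have "r_tilde r ` {P. partition_on S P} \<noteq> {}" by blast
  from Min_in[OF fin this]
  show "\<exists>P. partition_on S P \<and> r_prime r S = r_tilde r P"
    by (auto simp: r_prime_def)
  show "r_prime r S \<le> r_tilde r Q" if "partition_on S Q"
    using fin that by (auto simp: r_prime_def)
qed

lemma r_prime_empty: "r_prime r {} = 0"
  by (simp add: r_prime_def r_tilde_def partition_on_empty)

end

theory Submission
  imports Defs
begin

text \<open>
  The function \<open>f S = 2 * r S - 1\<close> is monotone, equals 1 on singletons, and is submodular on pairs of
  intersecting sets. Call \<open>X\<close> independent if \<open>card Y \<le> f Y\<close> for all nonempty \<open>Y \<subseteq> X\<close>, and call a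
  nonempty \<open>C \<subseteq> X\<close> tight if equality holds. Uncrossing shows that intersecting tight sets have a
  tight union, so the maximal tight sets partition \<open>X\<close>. If \<open>X\<close> is a maximal independent subset of
  \<open>S\<close>, then each \<open>e \<in> S - X\<close> can be added to one of these blocks without changing its \<open>f\<close>-value, and
  the enlarged blocks form a partition of \<open>S\<close> with value \<open>card X\<close>. No partition of \<open>S\<close> has a smaller
  value, so all maximal independent subsets of \<open>S\<close> have the same size \<open>r' S\<close>.
\<close>

section \<open>Rank functions of matroids\<close>

context matroid
begin

lemma finite_indep_subsets: "finite {X. X \<subseteq> S \<and> indep X}"
  by (rule finite_subset[of _ "Pow E"]) (use finite_ground indep_subset_ground in auto)

lemma finite_indep: "indep X \<Longrightarrow> finite X"
  using finite_ground indep_subset_ground finite_subset by blast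

lemma card_le_rank: "indep X \<Longrightarrow> X \<subseteq> S \<Longrightarrow> card X \<le> matroid_rank indep S"
  unfolding matroid_rank_def using finite_indep_subsets by (intro Max_ge) auto

lemma rank_attained: "\<exists>X\<subseteq>S. indep X \<and> card X = matroid_rank indep S"
proof -
  have "matroid_rank indep S \<in> card ` {X. X \<subseteq> S \<and> indep X}"
    unfolding matroid_rank_def using finite_indep_subsets indep_empty by (intro Max_in) blast+
  then show ?thesis by auto
qed

text \<open>An inclusion-maximal independent set between \<open>X\<close> and \<open>S\<close> has
  full rank: otherwise augmenting it from a largest independent subset of \<open>S\<close> would
  enlarge it.\<close>

lemma extend_to_basis:
  assumes "indep X" "X \<subseteq> S"
  shows "\<exists>B. X \<subseteq> B \<and> B \<subseteq> S \<and> indep B \<and> card B = matroid_rank indep S"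
proof -
  let ?A = "{B. B \<subseteq> S \<and> indep B}"
  have "X \<in> ?A" using assms by simp
  then obtain B where B: "B \<in> ?A" "X \<subseteq> B" and max: "\<And>Y. Y \<in> ?A \<Longrightarrow> B \<subseteq> Y \<Longrightarrow> B = Y"
    using finite_has_maximal2[OF finite_indep_subsets[of S], of X] by metis
  obtain Y where Y: "Y \<subseteq> S" "indep Y" "card Y = matroid_rank indep S"
    using rank_attained by blast
  have "\<not> card B < card Y"
  proof
    assume "card B < card Y"
    then obtain y where y: "y \<in> Y - B" "indep (insert y B)"
      using indep_augment B Y by blast
    then have "B = insert y B" using max[of "insert y B"] B Y by auto
    then show False using y by auto
  qed
  then show ?thesis using card_le_rank[of B S] B Y by auto
qed

lemma rank_mono:
  assumes "A \<subseteq> B" shows "matroid_rank indep A \<le> matroid_rank indep B"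
  by (metis assms card_le_rank order_trans rank_attained)

text \<open>Extend a basis \<open>I\<close> of \<open>A \<inter> B\<close> to a basis
  \<open>J\<close> of \<open>A \<union> B\<close> and count \<open>J\<close> through its independent
  parts \<open>J \<inter> A\<close> and \<open>J \<inter> B\<close>, whose intersection contains
  \<open>I\<close>.\<close>

lemma rank_submodular:
  "matroid_rank indep (A \<union> B) + matroid_rank indep (A \<inter> B)
    \<le> matroid_rank indep A + matroid_rank indep B"
proof -
  obtain I where I: "I \<subseteq> A \<inter> B" "indep I" "card I = matroid_rank indep (A \<inter> B)"
    using rank_attained by blast
  then obtain J where J: "I \<subseteq> J" "J \<subseteq> A \<union> B" "indep J" "card J = matroid_rank indep (A \<union> B)"
    using extend_to_basis[of I "A \<union> B"] by auto
  have fin: "finite J" using finite_indep J by blast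
  have "card (J \<inter> A) + card (J \<inter> B) = card ((J \<inter> A) \<union> (J \<inter> B)) + card ((J \<inter> A) \<inter> (J \<inter> B))"
    using fin by (intro card_Un_Int) auto
  also have "(J \<inter> A) \<union> (J \<inter> B) = J" using J by auto
  finally have *: "card (J \<inter> A) + card (J \<inter> B) = card J + card ((J \<inter> A) \<inter> (J \<inter> B))" .
  have "card I \<le> card ((J \<inter> A) \<inter> (J \<inter> B))" using I J fin by (intro card_mono) auto
  moreover have "card (J \<inter> A) \<le> matroid_rank indep A" "card (J \<inter> B) \<le> matroid_rank indep B"
    using J indep_hereditary by (auto intro!: card_le_rank)
  ultimately show ?thesis using * I J by linarith
qed

lemma rank_singleton:
  assumes "loopless E indep" "e \<in> E" shows "matroid_rank indep {e} = 1"
proof -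
  have "indep {e}" using assms by (auto simp: loopless_def is_loop_def)
  then have "1 \<le> matroid_rank indep {e}" using card_le_rank[of "{e}" "{e}"] by simp
  moreover obtain X where "X \<subseteq> {e}" "card X = matroid_rank indep {e}"
    using rank_attained by blast
  ultimately show ?thesis using card_mono[of "{e}" X] by auto
qed

end

section \<open>Matroids from intersecting submodular functions\<close>

locale intersecting_submodular =
  fixes E :: "'a set" and f :: "'a set \<Rightarrow> int"
  assumes finite_ground: "finite E"
    and mono: "A \<subseteq> B \<Longrightarrow> B \<subseteq> E \<Longrightarrow> A \<noteq> {} \<Longrightarrow> f A \<le> f B"
    and singleton: "e \<in> E \<Longrightarrow> f {e} = 1"
    and submodular:
      "A \<subseteq> E \<Longrightarrow> B \<subseteq> E \<Longrightarrow> A \<inter> B \<noteq> {} \<Longrightarrow> f (A \<union> B) + f (A \<inter> B) \<le> f A + f B"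
begin

text \<open>The empty set is exempt because the intended \<open>f\<close>, twice the rank minus one,
  is -1 there.\<close>

definition bounded :: "'a set \<Rightarrow> bool" where
  "bounded X \<longleftrightarrow> X \<subseteq> E \<and> (\<forall>Y\<subseteq>X. Y \<noteq> {} \<longrightarrow> int (card Y) \<le> f Y)"

definition tight :: "'a set \<Rightarrow> bool" where
  "tight C \<longleftrightarrow> C \<noteq> {} \<and> int (card C) = f C"

lemma bounded_subset: "bounded X \<Longrightarrow> Y \<subseteq> X \<Longrightarrow> bounded Y"
  unfolding bounded_def by blast

lemma finite_bounded: "bounded X \<Longrightarrow> finite X"
  unfolding bounded_def using finite_ground finite_subset by blast

text \<open>The easy half of the min-max formula: cut \<open>X\<close> along the blocks and bound
  each piece separately.\<close>

lemma bounded_card_le_partition: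
  assumes "bounded X" "X \<subseteq> S" "S \<subseteq> E" "partition_on S P"
  shows "int (card X) \<le> sum f P"
proof -
  have finS: "finite S" using assms finite_ground finite_subset by blast
  have finP: "finite P" using assms(4) finS finite_elements by blast
  have "(\<Union>p\<in>P. X \<inter> p) = X" using assms(2,4) by (auto simp: partition_on_def)
  then have "card X \<le> (\<Sum>p\<in>P. card (X \<inter> p))"
    using card_UN_le[OF finP, of "\<lambda>p. X \<inter> p"] by simp
  then have "int (card X) \<le> (\<Sum>p\<in>P. int (card (X \<inter> p)))"
    by (metis of_nat_mono of_nat_sum)
  also have "\<dots> \<le> sum f P"
  proof (rule sum_mono)
    fix p assume "p \<in> P"
    then have p: "p \<noteq> {}" "p \<subseteq> E" using assms(3,4) by (auto simp: partition_on_def)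
    show "int (card (X \<inter> p)) \<le> f p"
    proof (cases "X \<inter> p = {}")
      case True
      \<comment> \<open>A block missing \<open>X\<close> counts 0 on the left, and monotonicity from
        a singleton gives \<open>f p\<close> at least 1.\<close>
      obtain e where "e \<in> p" using p by auto
      then have "f {e} \<le> f p" "e \<in> E" using p mono[of "{e}" p] by auto
      then show ?thesis using True singleton by simp
    next
      case False
      then have "int (card (X \<inter> p)) \<le> f (X \<inter> p)" using assms(1) by (auto simp: bounded_def)
      also have "\<dots> \<le> f p" using False p mono by auto
      finally show ?thesis .
    qed
  qed
  finally show ?thesis .
qed

text \<open>Cardinality is modular and \<open>f\<close> is submodular on this pair, so the bounds
  for union and intersection must both be equalities.\<close>

lemma tight_Un:
  assumes "bounded X" "C \<subseteq> X" "D \<subseteq> X" "tight C" "tight D" "C \<inter> D \<noteq> {}"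
  shows "tight (C \<union> D)"
proof -
  have "finite C" "finite D" using assms finite_bounded finite_subset by blast+
  then have "card C + card D = card (C \<union> D) + card (C \<inter> D)" by (rule card_Un_Int)
  then have card: "int (card C) + int (card D) = int (card (C \<union> D)) + int (card (C \<inter> D))"
    by linarith
  have "C \<subseteq> E" "D \<subseteq> E" using assms by (auto simp: bounded_def)
  then have sub: "f (C \<union> D) + f (C \<inter> D) \<le> f C + f D" using submodular assms by blast
  have "C \<union> D \<subseteq> X" "C \<inter> D \<subseteq> X" "C \<union> D \<noteq> {}" using assms by auto
  then have "int (card (C \<union> D)) \<le> f (C \<union> D)" "int (card (C \<inter> D)) \<le> f (C \<inter> D)"
    using assms unfolding bounded_def by blast+
  moreover have "f C = int (card C)" "f D = int (card D)" using assms by (auto simp: tight_def)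
  ultimately have "int (card (C \<union> D)) = f (C \<union> D)" using card sub by linarith
  then show ?thesis using assms by (auto simp: tight_def)
qed

text \<open>Diminishing returns: for \<open>e\<close> outside \<open>D\<close>, submodularity on
  \<open>insert e C\<close> and \<open>D\<close>, which meet in \<open>C\<close>, bounds the gain of
  \<open>e\<close> over \<open>D\<close> by its zero gain over \<open>C\<close>.\<close>

lemma spanned_by_superset:
  assumes "C \<subseteq> D" "C \<noteq> {}" "D \<subseteq> E" "e \<in> E" "f (insert e C) = f C"
  shows "f (insert e D) = f D"
proof (cases "e \<in> D")
  case False
  have "f (insert e C \<union> D) + f (insert e C \<inter> D) \<le> f (insert e C) + f D"
    using assms by (intro submodular) auto
  moreover have "insert e C \<union> D = insert e D" "insert e C \<inter> D = C" using assms False by auto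
  moreover have "f D \<le> f (insert e D)" using assms by (intro mono) auto
  ultimately show ?thesis using assms by auto
qed (simp add: insert_absorb)

lemma spanned_Un:
  assumes "finite D" "D \<subseteq> E" "C \<subseteq> E" "C \<noteq> {}" "\<And>e. e \<in> D \<Longrightarrow> f (insert e C) = f C"
  shows "f (C \<union> D) = f C"
  using assms
proof (induction D rule: finite_induct)
  case (insert e D)
  have "f (insert e (C \<union> D)) = f (C \<union> D)"
    by (rule spanned_by_superset[of C]) (use insert.prems in auto)
  then show ?case using insert by simp
qed simp

text \<open>Singletons are tight, so the maximal tight sets cover \<open>X\<close>; two that meet
  have a tight union and hence coincide.\<close>

lemma maximal_tight_partition:
  assumes "bounded X"
  shows "\<exists>P. partition_on X P \<and> (\<forall>C\<in>P. tight C) \<and> (\<forall>C\<subseteq>X. tight C \<longrightarrow> (\<exists>D\<in>P. C \<subseteq> D))"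
proof -
  define T where "T = {C. C \<subseteq> X \<and> tight C}"
  define P where "P = {C \<in> T. \<forall>D\<in>T. C \<subseteq> D \<longrightarrow> C = D}"
  have finT: "finite T" unfolding T_def using finite_bounded[OF assms] by simp
  have below: "\<exists>D\<in>P. C \<subseteq> D" if "C \<in> T" for C
    using finite_has_maximal2[OF finT that] unfolding P_def by blast
  have "partition_on X P"
  proof (rule partition_onI)
    show "\<Union> P = X"
    proof
      show "\<Union> P \<subseteq> X" by (auto simp: P_def T_def)
      show "X \<subseteq> \<Union> P"
      proof
        fix x assume "x \<in> X"
        then have "{x} \<in> T" using assms singleton by (auto simp: T_def tight_def bounded_def)
        then show "x \<in> \<Union> P" using below by blast
      qed
    qed
    show "disjnt C D" if "C \<in> P" "D \<in> P" "C \<noteq> D" for C D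
    proof (rule ccontr)
      assume "\<not> disjnt C D"
      then have "C \<union> D \<in> T"
        using that tight_Un[OF assms, of C D] by (auto simp: P_def T_def disjnt_def)
      then have "C = C \<union> D" "D = C \<union> D" using that by (auto simp: P_def)
      then show False using that by simp
    qed
    show "{} \<notin> P" by (auto simp: P_def T_def tight_def)
  qed
  then show ?thesis using below by (intro exI[of _ P]) (auto simp: P_def T_def)
qed

text \<open>A violating \<open>Y\<close> must contain \<open>e\<close>. For
  \<open>C = Y - {e}\<close>, the chain \<open>card C \<le> f C \<le> f Y < card C + 1\<close>
  collapses over the integers.\<close>

lemma unbounded_insert:
  assumes "bounded X" "e \<in> E" "\<not> bounded (insert e X)"
  shows "\<exists>C\<subseteq>X. tight C \<and> f (insert e C) = f C"
proof -
  obtain Y where Y: "Y \<subseteq> insert e X" "Y \<noteq> {}" "f Y < int (card Y)"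
    using assms by (auto simp: bounded_def not_le)
  define C where "C = Y - {e}"
  have C: "C \<subseteq> X" using Y C_def by auto
  have e: "e \<in> Y"
  proof (rule ccontr)
    assume "e \<notin> Y"
    then have "Y \<subseteq> X" using Y by blast
    then have "int (card Y) \<le> f Y" using Y(2) assms(1) unfolding bounded_def by blast
    then show False using Y by simp
  qed
  then have Yeq: "Y = insert e C" "e \<notin> C" by (auto simp: C_def)
  \<comment> \<open>Otherwise \<open>Y = {e}\<close>, which satisfies its bound since
    \<open>f {e} = 1\<close>.\<close>
  have "C \<noteq> {}" using Y Yeq singleton assms(2) by auto
  moreover have "finite C" using C finite_bounded[OF assms(1)] finite_subset by blast
  ultimately have "int (card C) \<le> f C" "card Y = Suc (card C)" "f C \<le> f Y"
    using C Yeq assms mono[of C Y] by (auto simp: bounded_def)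
  then have "int (card C) = f C" "f Y = f C" using Y by linarith+
  then show ?thesis using C Yeq \<open>C \<noteq> {}\<close> by (auto simp: tight_def)
qed

lemma maximal_bounded_partition:
  assumes "bounded X" "X \<subseteq> S" "S \<subseteq> E" "\<And>e. e \<in> S - X \<Longrightarrow> \<not> bounded (insert e X)"
  shows "\<exists>Q. partition_on S Q \<and> sum f Q = int (card X)"
proof -
  obtain P where P: "partition_on X P" "\<And>C. C \<in> P \<Longrightarrow> tight C"
    and below: "\<And>C. C \<subseteq> X \<Longrightarrow> tight C \<Longrightarrow> \<exists>D\<in>P. C \<subseteq> D"
    using maximal_tight_partition[OF assms(1)] by blast
  have finX: "finite X" using assms finite_bounded by blast
  have PE: "C \<subseteq> E" "C \<noteq> {}" "C \<subseteq> X" if "C \<in> P" for C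
    using that P(1) assms by (auto simp: partition_on_def)
  have "\<exists>D\<in>P. f (insert e D) = f D" if e: "e \<in> S - X" for e
  proof -
    obtain C where C: "C \<subseteq> X" "tight C" "f (insert e C) = f C"
      using unbounded_insert[OF assms(1) _ assms(4)[OF e]] assms(3) e by auto
    then obtain D where D: "D \<in> P" "C \<subseteq> D" using below by blast
    have "f (insert e D) = f D"
      by (rule spanned_by_superset[OF D(2)]) (use C e assms(3) D PE in \<open>auto simp: tight_def\<close>)
    then show ?thesis using D by blast
  qed
  then obtain g where g: "\<And>e. e \<in> S - X \<Longrightarrow> g e \<in> P \<and> f (insert e (g e)) = f (g e)"
    by metis
  \<comment> \<open>Each block absorbs the elements that \<open>g\<close> assigns to it, all of them
    spanned by the block.\<close>
  define h where "h C = C \<union> {e \<in> S - X. g e = C}" for C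
  have h_X: "h C \<inter> X = C" if "C \<in> P" for C using PE[OF that] by (auto simp: h_def)
  then have inj: "inj_on h P" by (intro inj_onI) metis
  have fh: "f (h C) = f C" if "C \<in> P" for C
    unfolding h_def
    using that g assms PE[OF that] finite_subset[OF assms(3) finite_ground]
    by (intro spanned_Un) auto
  have "partition_on S (h ` P)"
  proof (rule partition_onI)
    show "\<Union> (h ` P) = S"
      using partition_onD1[OF P(1)] g assms(2) by (auto simp: h_def)
    show "{} \<notin> h ` P" using PE by (auto simp: h_def)
    show "disjnt p q" if pq: "p \<in> h ` P" "q \<in> h ` P" "p \<noteq> q" for p q
    proof -
      obtain C D where CD: "C \<in> P" "D \<in> P" "p = h C" "q = h D" "C \<noteq> D" using pq by auto
      then have "C \<inter> D = {}" using P(1) by (auto simp: partition_on_def disjoint_def)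
      then show ?thesis using CD PE[of C] PE[of D] by (auto simp: h_def disjnt_def)
    qed
  qed
  moreover have "sum f (h ` P) = int (card X)"
  proof -
    have "sum f (h ` P) = (\<Sum>C\<in>P. f (h C))" using inj by (simp add: sum.reindex)
    also have "\<dots> = (\<Sum>C\<in>P. int (card C))" using fh P(2) by (intro sum.cong) (auto simp: tight_def)
    also have "\<dots> = int (\<Sum>C\<in>P. card C)" by simp
    also have "(\<Sum>C\<in>P. card C) = card (\<Union> P)"
      using partition_onD2[OF P(1)] finite_subset[OF PE(3) finX]
      by (intro card_Union_disjoint[symmetric]) auto
    also have "\<Union> P = X" using P(1) by (auto simp: partition_on_def)
    finally show ?thesis .
  qed
  ultimately show ?thesis by blast
qed

section \<open>The matroid of bounded sets and its rank\<close>

lemma matroid_bounded: "matroid E bounded"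
proof
  show "finite E" by (rule finite_ground)
  show "bounded X \<Longrightarrow> X \<subseteq> E" for X by (simp add: bounded_def)
  show "bounded {}" by (simp add: bounded_def)
  show "bounded X \<Longrightarrow> Y \<subseteq> X \<Longrightarrow> bounded Y" for X Y by (rule bounded_subset)
  fix X Y assume XY: "bounded X" "bounded Y" "card X < card Y"
  show "\<exists>y\<in>Y - X. bounded (insert y X)"
  proof (rule ccontr)
    \<comment> \<open>Then \<open>X\<close> is maximal bounded in \<open>X \<union> Y\<close>,
      giving a partition of value \<open>card X\<close>, too small for the larger bounded set
      \<open>Y\<close>.\<close>
    assume "\<not> ?thesis"
    moreover have "X \<union> Y \<subseteq> E" using XY by (auto simp: bounded_def)
    ultimately obtain Q where "partition_on (X \<union> Y) Q" "sum f Q = int (card X)"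
      using maximal_bounded_partition[of X "X \<union> Y"] XY by auto
    then show False
      using bounded_card_le_partition[of Y "X \<union> Y" Q] XY \<open>X \<union> Y \<subseteq> E\<close> by auto
  qed
qed

lemma rank_bounded_attained:
  assumes "S \<subseteq> E"
  shows "\<exists>Q. partition_on S Q \<and> sum f Q = int (matroid_rank bounded S)"
proof -
  interpret B: matroid E bounded by (rule matroid_bounded)
  obtain X where X: "X \<subseteq> S" "bounded X" "card X = matroid_rank bounded S"
    using B.rank_attained by blast
  have "\<not> bounded (insert e X)" if "e \<in> S - X" for e
    using that X B.card_le_rank[of "insert e X" S] finite_bounded[of X] by auto
  then show ?thesis using maximal_bounded_partition[of X S] X assms by auto
qed

lemma rank_bounded_le:
  assumes "S \<subseteq> E" "partition_on S Q"
  shows "int (matroid_rank bounded S) \<le> sum f Q"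
proof -
  interpret B: matroid E bounded by (rule matroid_bounded)
  show ?thesis using B.rank_attained[of S] bounded_card_le_partition[of _ S Q] assms by metis
qed

end

section \<open>Application to twice the rank minus one\<close>

theorem theorem1p4:
  fixes E :: "'a set" and indep :: "'a set \<Rightarrow> bool"
  assumes "matroid E indep" and "loopless E indep"
  shows "\<exists>indep'. matroid E indep' \<and>
    (\<forall>S\<subseteq>E. int (matroid_rank indep' S) = r_prime (matroid_rank indep) S)"
proof -
  interpret M: matroid E indep by (rule assms(1))
  define f where "f S = 2 * int (matroid_rank indep S) - 1" for S
  have r_tilde: "r_tilde (matroid_rank indep) Q = sum f Q" for Q
    by (simp add: r_tilde_def f_def)
  interpret F: intersecting_submodular E f
  proof
    show "finite E" by (rule M.finite_ground)
    show "f A \<le> f B" if "A \<subseteq> B" for A B using M.rank_mono[OF that] by (simp add: f_def)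
    \<comment> \<open>Looplessness enters here: a loop would give the value -1.\<close>
    show "f {e} = 1" if "e \<in> E" for e using M.rank_singleton[OF assms(2) that] by (simp add: f_def)
    show "f (A \<union> B) + f (A \<inter> B) \<le> f A + f B" for A B
      using M.rank_submodular[of A B] by (simp add: f_def)
  qed
  have "int (matroid_rank F.bounded S) = r_prime (matroid_rank indep) S" if "S \<subseteq> E" for S
  proof (rule antisym)
    have fin: "finite S" using that M.finite_ground finite_subset by blast
    show "int (matroid_rank F.bounded S) \<le> r_prime (matroid_rank indep) S"
      using r_prime_attained(1)[OF fin] F.rank_bounded_le[OF that] by (metis r_tilde)
    show "r_prime (matroid_rank indep) S \<le> int (matroid_rank F.bounded S)"
      using r_prime_attained(2)[OF fin] F.rank_bounded_attained[OF that] by (metis r_tilde)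
  qed
  then show ?thesis using F.matroid_bounded by blast
qed

end
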